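(* Suppose a Polish group $G$ acts in a Borel manner and essentially freely on a standard probability space $(X,\mu)$, and that $[\mathcal R_G]=\mathrm{Aut}(X,\mu)$. Then $G$ is compact.
   Context: A standard probability space is a standard Borel space equipped with a non-atomic Borel probability measure. $\mathrm{Aut}(X,\mu)$ is the group of measure-preserving Borel bijections of $(X,\mu)$, identified when equal almost everywhere. A Borel action means that the action map $G\times X\to X$ is Borel. The orbit full group is $[\mathcal R_G]=\{T\in\mathrm{Aut}(X,\mu): T(x)\in G\cdot x\text{ for all (equivalently, almost all) }x\in X\}$. The action is essentially free if there is a full measure $G$-invariant subset $A\subseteq X$ such that $gx\neq x$ for every $g\in G\setminus\{1_G\}$ and every $x\in A$.
   Formalization: The action is additionally assumed to preserve the measure μ; without this the claim fails, e.g. for the real line translating itself with a Gaussian measure, where the action is Borel, free and transitive, so [R_G]=Aut(X,μ), but the group is not compact. *)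

theory Defs
  imports "HOL-Analysis.Analysis" "HOL-Probability.Probability_Measure"
begin

(* A Polish group is a type of class polish_space and topological_group_add. The latter class is
   the library's notion of a topological group: it is written additively, but addition is not
   assumed to be commutative. The metric carried by polish_space need not be invariant. *)

definition standard_borel_space :: "'x measure \<Rightarrow> bool" where
  "standard_borel_space M \<longleftrightarrow>
     (\<exists>T. topspace T = space M \<and> completely_metrizable_space T \<and> second_countable T \<and>
          sets M = sigma_sets (space M) {U. openin T U})"

definition nonatomic :: "'x measure \<Rightarrow> bool" where
  "nonatomic M \<longleftrightarrow>
     (\<forall>A\<in>sets M. emeasure M A > 0 \<longrightarrow>
        (\<exists>B\<in>sets M. B \<subseteq> A \<and> 0 < emeasure M B \<and> emeasure M B < emeasure M A))"

definition standard_prob_space :: "'x measure \<Rightarrow> bool" where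
  "standard_prob_space M \<longleftrightarrow> prob_space M \<and> standard_borel_space M \<and> nonatomic M"

(* On a standard Borel space the inverse of a Borel bijection is Borel (Lusin-Souslin), so
   measurability of the inverse is not required separately. *)
definition mp_bijections :: "'x measure \<Rightarrow> ('x \<Rightarrow> 'x) set" where
  "mp_bijections M =
     {T. T \<in> M \<rightarrow>\<^sub>M M \<and> bij_betw T (space M) (space M) \<and> distr M M T = M}"

definition ae_eq :: "'x measure \<Rightarrow> (('x \<Rightarrow> 'x) \<times> ('x \<Rightarrow> 'x)) set" where
  "ae_eq M = {(S, T). S \<in> mp_bijections M \<and> T \<in> mp_bijections M \<and> (AE x in M. S x = T x)}"

definition Aut :: "'x measure \<Rightarrow> ('x \<Rightarrow> 'x) set set" where
  "Aut M = mp_bijections M // ae_eq M"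

definition borel_action ::
  "'x measure \<Rightarrow> ('g::{topological_group_add,polish_space} \<Rightarrow> 'x \<Rightarrow> 'x) \<Rightarrow> bool" where
  "borel_action M act \<longleftrightarrow>
     (\<forall>x\<in>space M. act 0 x = x) \<and>
     (\<forall>g h. \<forall>x\<in>space M. act (g + h) x = act g (act h x)) \<and>
     (\<lambda>(g, x). act g x) \<in> borel \<Otimes>\<^sub>M M \<rightarrow>\<^sub>M M"

(* Invariance of the measure is needed below: the translation action of the reals on themselves,
   with a Gaussian measure, is free, Borel and transitive. *)
definition measure_preserving_action :: "'x measure \<Rightarrow> ('g \<Rightarrow> 'x \<Rightarrow> 'x) \<Rightarrow> bool" where
  "measure_preserving_action M act \<longleftrightarrow> (\<forall>g. distr M M (act g) = M)"

definition orbit :: "('g \<Rightarrow> 'x \<Rightarrow> 'x) \<Rightarrow> 'x \<Rightarrow> 'x set" where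
  "orbit act x = range (\<lambda>g. act g x)"

(* The almost-everywhere form of the orbit condition is used because it does not depend on the
   representative T; every such class has a representative satisfying it everywhere. *)
definition orbit_full_group :: "'x measure \<Rightarrow> ('g \<Rightarrow> 'x \<Rightarrow> 'x) \<Rightarrow> ('x \<Rightarrow> 'x) set set" where
  "orbit_full_group M act = {C \<in> Aut M. \<forall>T\<in>C. AE x in M. T x \<in> orbit act x}"

definition essentially_free :: "'x measure \<Rightarrow> ('g::group_add \<Rightarrow> 'x \<Rightarrow> 'x) \<Rightarrow> bool" where
  "essentially_free M act \<longleftrightarrow>
     (\<exists>A\<subseteq>space M. (AE x in M. x \<in> A) \<and> (\<forall>g. \<forall>x\<in>A. act g x \<in> A) \<and>
        (\<forall>g. g \<noteq> 0 \<longrightarrow> (\<forall>x\<in>A. act g x \<noteq> x)))"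

end

(* The orbit relation R is shown to be conull in X x X: identify X with the unit interval up to null
   sets and let T_t be the transported circle reflection u -> t - u. Every T_t lies in the orbit full
   group, and for fixed x the point T_t x is distributed like the measure of X when t is uniform, so
   Fubini applies. As R is a projection of a Borel set, Choquet's capacitability argument gives a
   compact K in G and a point x0 with K x0 containing a measurable set of measure above 1/2. Since G
   preserves the measure, g K x0 meets K x0 for every g, whence G = K - K by freeness. *)

theory Submission
  imports Defs "HOL-Probability.Probability"
begin

text \<open>The hypothesis controls one automorphism at a time, up to a null set depending on it,
  while compactness asks for a single orbit seen as a whole. A measurable one-parameter family
  bridges the gap: uncountably many null sets can be averaged but not united. The group need not be
  a countable union of compact sets, so \<open>K\<close> cannot come from exhausting it. It is cut
  out scale by scale by totally bounded conditions while the projected set keeps its outer measure.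
  Outer measure is the notion used because the orbit relation is handled only as an analytic set;
  conull then means that every measurable superset has full measure. Two codings by reals coexist.
  The map \<open>c\<close> is injective on the whole space and turns the orbit relation into a
  projection of a Borel set over the plane; \<open>\<phi>\<close> is invertible only almost
  everywhere, but it carries the measure to the uniform one, on which the reflections act.\<close>

section \<open>Borel sets as projections of closed sets\<close>

text \<open>Over a Polish space these are the analytic (Suslin) sets. Real sequences serve as
  witnesses because one of them can store countably many others, or an additional index, and because
  they form a Polish space.\<close>

definition closed_projection :: "'a::topological_space set \<Rightarrow> bool" where
  "closed_projection P \<longleftrightarrow> (\<exists>F :: ('a \<times> (nat \<Rightarrow> real)) set. closed F \<and> P = fst ` F)"

lemma continuous_on_snd_coordinate:
  "continuous_on UNIV (\<lambda>p :: 'a::topological_space \<times> ('j \<Rightarrow> 'b::topological_space). snd p i)"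
  by (rule continuous_on_product_then_coordinatewise[OF continuous_on_snd[OF continuous_on_id]])

lemma continuous_on_reindex:
  fixes \<phi> :: "'i \<Rightarrow> 'j"
  shows "continuous_on UNIV (\<lambda>(w :: 'a::topological_space, z :: 'j \<Rightarrow> 'b::topological_space). (w, \<lambda>k. z (\<phi> k)))"
  unfolding case_prod_unfold
  by (rule continuous_on_Pair[OF continuous_on_fst[OF continuous_on_id]
        continuous_on_coordinatewise_then_product[OF continuous_on_snd_coordinate]])

lemma closed_projection_closed:
  assumes "closed P" shows "closed_projection P"
  unfolding closed_projection_def
proof (intro exI conjI)
  show "closed (P \<times> (UNIV :: (nat \<Rightarrow> real) set))"
    using assms by (intro closed_Times) auto
qed auto

text \<open>One sequence carries a witness for every \<open>P n\<close> at once, the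
  \<open>n\<close>-th along the indices \<open>prod_encode (n, k)\<close>.\<close>

lemma closed_projection_Inter:
  assumes "\<And>n::nat. closed_projection (P n)"
  shows "closed_projection (\<Inter>n. P n)"
proof -
  obtain F where F: "\<And>n. closed (F n)" "\<And>n. P n = fst ` (F n :: ('a \<times> (nat \<Rightarrow> real)) set)"
    using assms unfolding closed_projection_def by metis
  define r where "r n = (\<lambda>(w::'a, z :: nat \<Rightarrow> real). (w, \<lambda>k. z (prod_encode (n, k))))" for n
  define E where "E = (\<Inter>n. r n -` F n)"
  have "closed E" unfolding E_def r_def
    by (intro closed_INT ballI closed_vimage F continuous_on_reindex)
  moreover have "(\<Inter>n. P n) = fst ` E"
  proof (intro set_eqI iffI)
    fix w assume "w \<in> (\<Inter>n. P n)"
    then have "\<exists>z. (w, z) \<in> F n" for n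
      using F(2)[of n] by force
    then obtain z where z: "\<And>n. (w, z n) \<in> F n" by metis
    define y where "y i = z (fst (prod_decode i)) (snd (prod_decode i))" for i
    have "(w, y) \<in> E" using z by (auto simp: E_def r_def y_def)
    then show "w \<in> fst ` E" by force
  next
    fix w assume "w \<in> fst ` E"
    then show "w \<in> (\<Inter>n. P n)"
      using F(2) by (force simp: E_def r_def)
  qed
  ultimately show ?thesis unfolding closed_projection_def by blast
qed

text \<open>Coordinate 0 of the witness records which set is used. The pieces lie over distinct
  naturals, which are at distance at least 1 from each other, so their union stays closed.\<close>

lemma closed_projection_Union:
  assumes "\<And>n::nat. closed_projection (P n)"
  shows "closed_projection (\<Union>n. P n)"
proof -
  obtain F where F: "\<And>n. closed (F n)" "\<And>n. P n = fst ` (F n :: ('a \<times> (nat \<Rightarrow> real)) set)"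
    using assms unfolding closed_projection_def by metis
  define r where "r = (\<lambda>(w::'a, z :: nat \<Rightarrow> real). (w, \<lambda>k. z (Suc k)))"
  define E where "E = {p. \<exists>n. snd p 0 = real n \<and> r p \<in> F n}"
  have op: "open {p :: 'a \<times> (nat \<Rightarrow> real). Q (snd p 0)}" if "open (Collect Q)" for Q
    using open_vimage[OF that, of "\<lambda>p :: 'a \<times> (nat \<Rightarrow> real). snd p 0"]
    by (simp add: continuous_on_snd_coordinate vimage_def)
  \<comment> \<open>Local description of the complement: a non-natural coordinate 0 stays so nearby,
    and a natural at distance less than 1 from \<open>n\<close> is \<open>n\<close>, so only
    \<open>F n\<close> matters there.\<close>
  have E_eq: "- E = {p. snd p 0 \<notin> \<nat>} \<union> (\<Union>n. {p. \<bar>snd p 0 - real n\<bar> < 1} \<inter> - (r -` F n))"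
  proof (intro set_eqI iffI)
    fix p :: "'a \<times> (nat \<Rightarrow> real)" assume p: "p \<in> - E"
    show "p \<in> {p. snd p 0 \<notin> \<nat>} \<union> (\<Union>n. {p. \<bar>snd p 0 - real n\<bar> < 1} \<inter> - (r -` F n))"
    proof (cases "snd p 0 \<in> \<nat>")
      case True
      then obtain n where "snd p 0 = real n" by (auto simp: Nats_def)
      then show ?thesis using p by (auto simp: E_def intro!: exI[of _ n])
    qed auto
  next
    fix p :: "'a \<times> (nat \<Rightarrow> real)"
    assume p: "p \<in> {p. snd p 0 \<notin> \<nat>} \<union> (\<Union>n. {p. \<bar>snd p 0 - real n\<bar> < 1} \<inter> - (r -` F n))"
    have "m = n" if "\<bar>real m - real n\<bar> < 1" for m n
    proof -
      have "\<bar>int m - int n\<bar> < 1" using that by linarith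
      then show ?thesis by simp
    qed
    then show "p \<in> - E" using p unfolding E_def Nats_def by fastforce
  qed
  have open_nonNat: "open {p :: 'a \<times> (nat \<Rightarrow> real). snd p 0 \<notin> \<nat>}"
    using closed_Nats[where 'a = real] by (intro op) (simp add: closed_def Compl_eq)
  have open_near: "open ({p. \<bar>snd p 0 - real n\<bar> < 1} \<inter> - (r -` F n))" for n
    unfolding r_def
    by (intro open_Int op open_Compl closed_vimage F continuous_on_reindex)
       (auto intro!: open_Collect_less continuous_intros)
  have "open (- E)" unfolding E_eq by (intro open_Un open_UN ballI open_nonNat open_near)
  then have "closed E" by (simp add: closed_def)
  moreover have "(\<Union>n. P n) = fst ` E"
  proof (intro set_eqI iffI)
    fix w assume "w \<in> (\<Union>n. P n)"
    then obtain n z where z: "(w, z) \<in> F n" using F(2) by force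
    have "(w, case_nat (real n) z) \<in> E" using z by (auto simp: E_def r_def)
    then show "w \<in> fst ` E" by force
  next
    fix w assume "w \<in> fst ` E"
    then show "w \<in> (\<Union>n. P n)"
      using F(2) by (force simp: E_def r_def)
  qed
  ultimately show ?thesis unfolding closed_projection_def by blast
qed

text \<open>Projections do not commute with complements, so the induction over the sigma-algebra
  carries each set together with its complement.\<close>

lemma closed_projection_borel:
  fixes P :: "'a::metric_space set"
  assumes "P \<in> sets borel"
  shows "closed_projection P"
proof -
  have "P \<in> sigma_sets UNIV {S. open S}" using assms by (simp add: sets_borel)
  then have "closed_projection P \<and> closed_projection (- P)"
  proof induction
    case (Basic S)
    then have "open S" by simp
    \<comment> \<open>An open set is a countable union of closed sets. The whole space is treated
      apart, since \<open>infdist\<close> to the empty set is 0 by convention.\<close>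
    have "closed {x. 1 / real (Suc n) \<le> infdist x (- S)}" for n
      by (intro closed_Collect_le continuous_intros)
    then have "closed_projection (\<Union>n. {x. 1 / real (Suc n) \<le> infdist x (- S)})" if "S \<noteq> UNIV"
      by (intro closed_projection_Union closed_projection_closed)
    moreover have "(\<Union>n. {x. 1 / real (Suc n) \<le> infdist x (- S)}) = S" if "S \<noteq> UNIV"
    proof (intro set_eqI iffI)
      fix x assume "x \<in> (\<Union>n. {x. 1 / real (Suc n) \<le> infdist x (- S)})"
      then obtain n where "1 / real (Suc n) \<le> infdist x (- S)" by auto
      moreover have "1 / real (Suc n) > 0" by simp
      ultimately have "infdist x (- S) \<noteq> 0" by linarith
      then show "x \<in> S" by (meson ComplI infdist_zero)
    next
      fix x assume "x \<in> S"
      then have "x \<notin> - S" by simp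
      then have "infdist x (- S) > 0"
        using in_closed_iff_infdist_zero[of "- S" x] \<open>open S\<close> that infdist_nonneg[of x "- S"]
        by (auto simp: less_le)
      then show "x \<in> (\<Union>n. {x. 1 / real (Suc n) \<le> infdist x (- S)})"
        using nat_approx_posE[of "infdist x (- S)"] by (auto intro: less_imp_le)
    qed
    ultimately have "closed_projection S"
      using closed_projection_closed[OF closed_UNIV] by metis
    then show ?case using \<open>open S\<close> by (simp add: closed_projection_closed closed_Compl)
  next
    case Empty
    show ?case by (simp add: closed_projection_closed)
  next
    case (Compl P)
    then show ?case by (simp flip: Compl_eq_Diff_UNIV)
  next
    case (Union P)
    have "closed_projection (\<Inter>n. - P n)" "closed_projection (\<Union>n. P n)"
      using Union.IH by (blast intro: closed_projection_Inter closed_projection_Union)+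
    then show ?case by (simp only: Compl_UN)
  qed
  then show ?thesis ..
qed

section \<open>Capacitability of projections along a Polish factor\<close>

instance prod :: (polish_space, polish_space) polish_space ..

text \<open>Only tails are covered, but adding the finitely many earlier terms as centres covers the
  whole range. The halved radius leaves room for passing to the closure, which is then
  compact.\<close>

lemma convergent_subseq_if_finitely_covered:
  fixes s :: "nat \<Rightarrow> 'b::complete_space"
  assumes "\<And>e. 0 < e \<Longrightarrow> \<exists>n C. finite C \<and> (\<forall>m\<ge>n. s m \<in> (\<Union>c\<in>C. ball c e))"
  obtains l r where "strict_mono r" "(s \<circ> r) \<longlonglongrightarrow> l"
proof -
  define R where "R = closure (range s)"
  have "compact R"
    unfolding compact_eq_totally_bounded
  proof (intro conjI allI impI)
    show "Topological_Spaces.complete R" by (simp add: R_def complete_eq_closed)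
    fix e :: real assume "0 < e"
    then obtain n C where C: "finite C" "\<And>m. n \<le> m \<Longrightarrow> s m \<in> (\<Union>c\<in>C. ball c (e/2))"
      using assms[of "e/2"] by auto
    have "s m \<in> (\<Union>c\<in>C \<union> s ` {..<n}. cball c (e/2))" for m
    proof (cases "m < n")
      case True
      then show ?thesis using \<open>0 < e\<close> by (intro UN_I[of "s m"]) auto
    next
      case False
      then obtain c where "c \<in> C" "s m \<in> ball c (e/2)" using C(2)[of m] by auto
      then show ?thesis by (intro UN_I[of c]) auto
    qed
    then have "R \<subseteq> (\<Union>c\<in>C \<union> s ` {..<n}. cball c (e/2))"
      unfolding R_def using C(1) by (intro closure_minimal closed_UN) (blast, auto)
    also have "\<dots> \<subseteq> (\<Union>c\<in>C \<union> s ` {..<n}. ball c e)"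
      using \<open>0 < e\<close> by (intro UN_mono) auto
    finally show "\<exists>C. finite C \<and> R \<subseteq> (\<Union>c\<in>C. ball c e)"
      using C(1) by (intro exI[of _ "C \<union> s ` {..<n}"]) auto
  qed
  then have "seq_compact R" by (simp add: compact_eq_seq_compact_metric)
  moreover have "s n \<in> R" for n unfolding R_def using closure_subset[of "range s"] by blast
  ultimately obtain l r where "strict_mono r" "(s \<circ> r) \<longlonglongrightarrow> l"
    using seq_compactE[of R s] by metis
  then show ?thesis by (rule that)
qed

text \<open>For any choice of \<open>k\<close>, the set \<open>\<Inter>n. B n (k n)\<close> is
  closed and totally bounded, hence compact. This is how a compact set is built without local
  compactness.\<close>

lemma finite_ball_covers_exhaust:
  obtains B :: "nat \<Rightarrow> nat \<Rightarrow> 'b::polish_space set"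
  where "\<And>n k. closed (B n k)" "\<And>n. incseq (B n)" "\<And>n. (\<Union>k. B n k) = UNIV"
    and "\<And>n k e. 1 / real (Suc n) < e \<Longrightarrow> \<exists>C. finite C \<and> B n k \<subseteq> (\<Union>c\<in>C. ball c e)"
proof -
  obtain D :: "'b set" where D: "countable D" "\<And>U. open U \<Longrightarrow> U \<noteq> {} \<Longrightarrow> \<exists>d\<in>D. d \<in> U"
    using countable_dense_setE by blast
  define q where "q = from_nat_into D"
  define B where "B n k = (\<Union>i\<le>k. cball (q i) (1 / real (Suc n)))" for n k
  show ?thesis
  proof
    show "closed (B n k)" for n k
      unfolding B_def by (intro closed_UN) auto
    show "incseq (B n)" for n
      unfolding B_def incseq_def by (intro allI impI UN_mono) auto
    show "(\<Union>k. B n k) = UNIV" for n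
    proof -
      have "\<exists>k. x \<in> B n k" for x
      proof -
        have "ball x (1 / real (Suc n)) \<noteq> {}" by simp
        then obtain d where d: "d \<in> D" "d \<in> ball x (1 / real (Suc n))"
          using D(2) open_ball by blast
        obtain i where "q i = d"
          unfolding q_def using from_nat_into_surj[OF D(1) d(1)] by metis
        then have "x \<in> cball (q i) (1 / real (Suc n))" using d(2) by (simp add: dist_commute)
        then show ?thesis unfolding B_def by blast
      qed
      then show ?thesis by blast
    qed
    show "\<exists>C. finite C \<and> B n k \<subseteq> (\<Union>c\<in>C. ball c e)" if "1 / real (Suc n) < e" for n k e
    proof (intro exI conjI)
      show "B n k \<subseteq> (\<Union>c\<in>q ` {..k}. ball c e)"
        unfolding B_def UN_simps using that by (intro UN_mono) (auto simp del: of_nat_Suc)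
    qed auto
  qed
qed

text \<open>Choquet's capacitability argument: the second coordinate is successively confined to finite
  unions of balls of radius \<open>1/(n+1)\<close>, keeping the outer measure of the projection above \<open>a\<close>.\<close>

lemma projection_closed_inner_regular:
  fixes F :: "('a::metric_space \<times> 'b::polish_space) set"
  assumes "finite_measure N" and sets: "sets N = sets borel"
    and "closed F" and "a < outer_measure_of N (fst ` F)"
  obtains K where "compact K" "closed (fst ` (F \<inter> UNIV \<times> K))" "a \<le> emeasure N (fst ` (F \<inter> UNIV \<times> K))"
proof -
  interpret finite_measure N by fact
  have space: "space N = UNIV" using sets_eq_imp_space_eq[OF sets] by simp
  define pr where "pr S = fst ` (F \<inter> UNIV \<times> S)" for S
  have pr_mono: "S \<subseteq> S' \<Longrightarrow> pr S \<subseteq> pr S'" for S S' by (auto simp: pr_def)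
  obtain B :: "nat \<Rightarrow> nat \<Rightarrow> 'b set" where
    B: "\<And>n k. closed (B n k)" "\<And>n. incseq (B n)" "\<And>n. (\<Union>k. B n k) = UNIV"
    "\<And>n k e. 1 / real (Suc n) < e \<Longrightarrow> \<exists>C. finite C \<and> B n k \<subseteq> (\<Union>c\<in>C. ball c e)"
    using finite_ball_covers_exhaust by blast
  \<comment> \<open>Outer measure is continuous along increasing sequences of arbitrary sets, so one
    of the pieces \<open>B n k\<close> already keeps it above \<open>a\<close>.\<close>
  have step: "\<exists>k. a < outer_measure_of N (pr (S \<inter> B n k))" if "a < outer_measure_of N (pr S)" for S n
  proof -
    have "incseq (\<lambda>k. pr (S \<inter> B n k))"
      using B(2)[of n] unfolding incseq_def by (intro allI impI pr_mono Int_mono) auto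
    then have "(SUP k. outer_measure_of N (pr (S \<inter> B n k))) = outer_measure_of N (\<Union>k. pr (S \<inter> B n k))"
      by (intro SUP_outer_measure_of_incseq) (auto simp: space)
    also have "(\<Union>k. pr (S \<inter> B n k)) = pr (S \<inter> (\<Union>k. B n k))"
      unfolding pr_def by blast
    finally have "a < (SUP k. outer_measure_of N (pr (S \<inter> B n k)))" using that by (simp add: B(3))
    then show ?thesis by (simp add: less_SUP_iff)
  qed
  have "\<exists>S. \<forall>n. (a < outer_measure_of N (pr (S n)) \<and> (n = 0 \<longrightarrow> S n = UNIV)) \<and> (\<exists>k. S (Suc n) = S n \<inter> B n k)"
  proof (rule dependent_nat_choice)
    show "\<exists>S. a < outer_measure_of N (pr S) \<and> ((0::nat) = 0 \<longrightarrow> S = UNIV)"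
      using assms(4) by (intro exI[of _ UNIV]) (simp add: pr_def)
    fix S and n :: nat assume "a < outer_measure_of N (pr S) \<and> (n = 0 \<longrightarrow> S = UNIV)"
    then obtain k where "a < outer_measure_of N (pr (S \<inter> B n k))" using step by metis
    then show "\<exists>S'. (a < outer_measure_of N (pr S') \<and> (Suc n = 0 \<longrightarrow> S' = UNIV)) \<and> (\<exists>k. S' = S \<inter> B n k)"
      by (intro exI conjI) auto
  qed
  then obtain S where S: "\<And>n. a < outer_measure_of N (pr (S n))" "S 0 = UNIV"
    "\<And>n. \<exists>k. S (Suc n) = S n \<inter> B n k"
    by metis
  obtain k where k: "\<And>n. S (Suc n) = S n \<inter> B n (k n)" using S(3) by metis
  have dec: "S m \<subseteq> S n" if "n \<le> m" for m n
    using decseq_SucI[of S] k that unfolding decseq_def by blast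
  define K where "K = (\<Inter>n. B n (k n))"
  have "K \<subseteq> S n" for n
    by (induction n) (auto simp: k S(2) K_def)
  have "compact K"
    unfolding compact_eq_totally_bounded
  proof (intro conjI allI impI)
    show "Topological_Spaces.complete K" unfolding K_def complete_eq_closed by (intro closed_INT ballI B)
    fix e :: real assume "0 < e"
    then obtain n where "1 / real (Suc n) < e" using nat_approx_posE by metis
    then obtain C where "finite C" "B n (k n) \<subseteq> (\<Union>c\<in>C. ball c e)" using B(4) by metis
    then show "\<exists>C. finite C \<and> K \<subseteq> (\<Union>c\<in>C. ball c e)"
      by (intro exI[of _ C]) (auto simp: K_def)
  qed
  \<comment> \<open>The crux: a point approximated at every stage has approximants with witnesses
    that eventually lie in each \<open>B n (k n)\<close>. A subsequence of the witnesses converges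
    into \<open>K\<close>, and closedness of \<open>F\<close> makes the limit a witness for the
    point itself.\<close>
  have "(\<Inter>n. closure (pr (S (Suc n)))) \<subseteq> pr K"
  proof
    fix y assume y: "y \<in> (\<Inter>n. closure (pr (S (Suc n))))"
    have "\<exists>x s. (x, s) \<in> F \<and> s \<in> S (Suc n) \<and> dist x y < 1 / real (Suc n)" for n
    proof -
      have "y \<in> closure (pr (S (Suc n)))" using y by blast
      then obtain x where "x \<in> pr (S (Suc n))" "dist x y < 1 / real (Suc n)"
        unfolding closure_approachable by (metis of_nat_0_less_iff zero_less_Suc zero_less_divide_1_iff)
      moreover from this(1) obtain s where "(x, s) \<in> F" "s \<in> S (Suc n)" by (auto simp: pr_def)
      ultimately show ?thesis by blast
    qed
    then obtain x s where xs: "\<And>n. (x n, s n) \<in> F" "\<And>n. s n \<in> S (Suc n)"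
      "\<And>n. dist (x n) y < 1 / real (Suc n)" by metis
    have sB: "s m \<in> B n (k n)" if "n \<le> m" for n m
      using xs(2)[of m] dec[of "Suc n" "Suc m"] that by (auto simp: k)
    have "\<exists>n C. finite C \<and> (\<forall>m\<ge>n. s m \<in> (\<Union>c\<in>C. ball c e))" if "0 < e" for e
    proof -
      obtain n where "1 / real (Suc n) < e" using nat_approx_posE[OF \<open>0 < e\<close>] by metis
      then obtain C where "finite C" "B n (k n) \<subseteq> (\<Union>c\<in>C. ball c e)" using B(4) by metis
      then show ?thesis using sB[of n] by (intro exI[of _ n] exI[of _ C]) blast
    qed
    then obtain l r where l: "strict_mono r" "(s \<circ> r) \<longlonglongrightarrow> l"
      using convergent_subseq_if_finitely_covered by blast
    have "x \<longlonglongrightarrow> y"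
    proof (rule metric_tendsto_imp_tendsto[OF LIMSEQ_inverse_real_of_nat])
      show "\<forall>\<^sub>F n in sequentially. dist (x n) y \<le> dist (inverse (real (Suc n))) 0"
        using xs(3) by (intro always_eventually allI) (simp add: inverse_eq_divide less_imp_le)
    qed
    then have "(x \<circ> r) \<longlonglongrightarrow> y" using l(1) LIMSEQ_subseq_LIMSEQ by blast
    then have "(\<lambda>n. ((x \<circ> r) n, (s \<circ> r) n)) \<longlonglongrightarrow> (y, l)"
      using l(2) by (rule tendsto_Pair)
    then have "(y, l) \<in> F" by (rule closed_sequentially[OF \<open>closed F\<close>, rotated]) (simp add: xs(1))
    moreover have "l \<in> B n (k n)" for n
    proof (rule Lim_in_closed_set[OF B(1) _ sequentially_bot l(2)])
      show "\<forall>\<^sub>F m in sequentially. (s \<circ> r) m \<in> B n (k n)"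
      proof (rule eventually_sequentiallyI[of n])
        fix m assume "n \<le> m"
        then have "n \<le> r m" using seq_suble[OF l(1), of m] by simp
        then show "(s \<circ> r) m \<in> B n (k n)" using sB by simp
      qed
    qed
    ultimately show "y \<in> pr K" by (force simp: pr_def K_def)
  qed
  moreover have "pr K \<subseteq> closure (pr (S (Suc n)))" for n
    using pr_mono[OF \<open>K \<subseteq> S (Suc n)\<close>] closure_subset by blast
  ultimately have K_eq: "pr K = (\<Inter>n. closure (pr (S (Suc n))))" by blast
  \<comment> \<open>Outer measure need not be continuous along decreasing sequences, but the measure
    of the closures is; the strict bound becomes weak in the limit.\<close>
  have "a \<le> emeasure N (closure (pr (S (Suc n))))" for n
  proof -
    have "a < outer_measure_of N (pr (S (Suc n)))" by (rule S(1))
    also have "\<dots> \<le> outer_measure_of N (closure (pr (S (Suc n))))"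
      by (intro outer_measure_of_mono closure_subset)
    also have "\<dots> = emeasure N (closure (pr (S (Suc n))))"
      by (intro outer_measure_of_eq) (simp add: sets)
    finally show ?thesis by simp
  qed
  moreover have "(INF n. emeasure N (closure (pr (S (Suc n))))) = emeasure N (\<Inter>n. closure (pr (S (Suc n))))"
    by (intro INF_emeasure_decseq decseq_SucI closure_mono pr_mono dec) (auto simp: sets)
  ultimately have "a \<le> emeasure N (pr K)" unfolding K_eq by (metis INF_greatest)
  moreover have "closed (pr K)" unfolding K_eq by auto
  ultimately show ?thesis using that[of K] \<open>compact K\<close> unfolding pr_def by blast
qed

text \<open>The real sequence witnessing that \<open>P\<close> is a projection is merged with the
  second coordinate into one Polish factor. The closed case gives a compact set there, and its image
  in \<open>'b\<close> is compact.\<close>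

lemma projection_borel_inner_regular:
  fixes P :: "('a::metric_space \<times> 'b::polish_space) set"
  assumes "finite_measure N" and "sets N = sets borel"
    and "P \<in> sets borel" and "a < outer_measure_of N (fst ` P)"
  obtains K C where "compact K" "closed C" "C \<subseteq> fst ` (P \<inter> UNIV \<times> K)" "a \<le> emeasure N C"
proof -
  obtain F :: "(('a \<times> 'b) \<times> (nat \<Rightarrow> real)) set" where F: "closed F" "P = fst ` F"
    using closed_projection_borel[OF assms(3)] unfolding closed_projection_def by blast
  define F' where "F' = (\<lambda>(y, g, z). ((y, g), z)) -` F"
  have "closed F'"
    unfolding F'_def case_prod_unfold by (intro closed_vimage F continuous_intros)
  moreover have "fst ` F' = fst ` P"
    by (auto simp: F'_def F(2) image_iff Bex_def split_paired_Ex) blast+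
  ultimately obtain K where K: "compact K" "closed (fst ` (F' \<inter> UNIV \<times> K))"
    "a \<le> emeasure N (fst ` (F' \<inter> UNIV \<times> K))"
    using projection_closed_inner_regular[OF assms(1,2), of F' a] assms(4) by metis
  show ?thesis
  proof
    show "compact (fst ` K)" by (intro compact_continuous_image continuous_intros K)
    show "fst ` (F' \<inter> UNIV \<times> K) \<subseteq> fst ` (P \<inter> UNIV \<times> fst ` K)"
      by (auto simp: F'_def F(2) image_iff Bex_def split_paired_Ex) blast
  qed (use K in auto)
qed

section \<open>Borel coding of a standard Borel space by reals\<close>

text \<open>Base 3 with digits 0 and 1 only: tails stay at most 1/2, so floors recover the digits
  without the ambiguity of binary expansions.\<close>

definition ternary_code :: "(nat \<Rightarrow> bool) \<Rightarrow> real" where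
  "ternary_code b = (\<Sum>i. of_bool (b i) / 3 ^ Suc i)"

lemma summable_ternary_code: "summable (\<lambda>i. of_bool (b i) / 3 ^ Suc i :: real)"
proof (rule summable_comparison_test')
  show "summable (\<lambda>i. (1/3 :: real) ^ i)" by (intro summable_geometric) simp
  show "norm (of_bool (b i) / 3 ^ Suc i :: real) \<le> (1/3) ^ i" for i
    by (simp add: power_one_over field_simps)
qed

lemma ternary_code_unfold: "ternary_code b = (of_bool (b 0) + ternary_code (\<lambda>i. b (Suc i))) / 3"
proof -
  have "(\<Sum>i. of_bool (b (Suc i)) / 3 ^ Suc (Suc i) :: real) = ternary_code (\<lambda>i. b (Suc i)) / 3"
    unfolding ternary_code_def using suminf_divide[OF summable_ternary_code[of "\<lambda>i. b (Suc i)"], of 3]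
    by (simp add: field_simps)
  then show ?thesis
    using suminf_split_head[OF summable_ternary_code[of b]] by (simp add: ternary_code_def field_simps)
qed

lemma ternary_code_bounds: "0 \<le> ternary_code b" "ternary_code b < 1"
proof -
  show "0 \<le> ternary_code b"
    unfolding ternary_code_def by (intro suminf_nonneg summable_ternary_code) simp
  have "ternary_code b \<le> (\<Sum>i. (1/3) * (1/3 :: real) ^ i)"
    unfolding ternary_code_def
    by (intro suminf_le summable_ternary_code summable_mult summable_geometric)
       (simp_all add: power_one_over field_simps)
  also have "\<dots> = 1/2"
    by (subst suminf_mult) (simp_all add: suminf_geometric summable_geometric)
  finally show "ternary_code b < 1" by simp
qed

lemma ternary_digit: "\<lfloor>ternary_code b * 3 ^ Suc j\<rfloor> mod 3 = of_bool (b j)"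
proof (induction j arbitrary: b)
  case 0
  have "ternary_code b * 3 = of_int (of_bool (b 0)) + ternary_code (\<lambda>i. b (Suc i))"
    by (subst ternary_code_unfold) (simp add: field_simps)
  then have "\<lfloor>ternary_code b * 3\<rfloor> = \<lfloor>of_int (of_bool (b 0)) + ternary_code (\<lambda>i. b (Suc i))\<rfloor>"
    by (rule arg_cong)
  also have "\<dots> = of_bool (b 0)"
    using ternary_code_bounds[of "\<lambda>i. b (Suc i)"] by linarith
  finally show ?case by simp
next
  case (Suc j)
  let ?r = "ternary_code (\<lambda>i. b (Suc i))"
  have "ternary_code b * 3 ^ Suc (Suc j) = ?r * 3 ^ Suc j + of_int (of_bool (b 0) * 3 ^ Suc j)"
    by (subst ternary_code_unfold) (simp add: field_simps)
  then have "\<lfloor>ternary_code b * 3 ^ Suc (Suc j)\<rfloor> = \<lfloor>?r * 3 ^ Suc j + of_int (of_bool (b 0) * 3 ^ Suc j)\<rfloor>"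
    by (rule arg_cong)
  also have "\<dots> = \<lfloor>?r * 3 ^ Suc j\<rfloor> + of_bool (b 0) * 3 ^ Suc j"
    by (rule floor_add_int[symmetric])
  also have "\<dots> mod 3 = \<lfloor>?r * 3 ^ Suc j\<rfloor> mod 3" by (simp add: mod_add_eq[symmetric])
  finally show ?case using Suc.IH by simp
qed

text \<open>A point \<open>x\<close> is coded by the bits \<open>d (q n) x < 2\<^sup>-\<^sup>k\<close> for a dense sequence \<open>q\<close>.  The decoding map
  takes the limit of the first points \<open>q n\<close> selected at each level \<open>k\<close>; it is only required to be a
  left inverse, so no description of the set of codes is needed.\<close>

lemma standard_borel_embedding:
  assumes "standard_borel_space M" and "space M \<noteq> {}"
  obtains c :: "'x \<Rightarrow> real" and dec where "c \<in> borel_measurable M" "dec \<in> borel \<rightarrow>\<^sub>M M"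
    "\<And>x. x \<in> space M \<Longrightarrow> dec (c x) = x"
proof -
  obtain T where T: "topspace T = space M" "completely_metrizable_space T" "second_countable T"
    "sets M = sigma_sets (space M) {U. openin T U}"
    using assms(1) unfolding standard_borel_space_def by blast
  obtain S d where S: "Metric_space S d" "Metric_space.mcomplete S d" "T = Metric_space.mtopology S d"
    using T(2) unfolding completely_metrizable_space_def by blast
  interpret Metric_space S d by (rule S(1))
  have space: "space M = S" using T(1) S(3) by simp
  obtain C where C: "countable C" "C \<subseteq> S" "T closure_of C = S"
    using second_countable_imp_separable_space[OF T(3)] S(3) unfolding separable_space_def by auto
  have "C \<noteq> {}" using C(3) assms(2) space by auto
  define q where "q = from_nat_into C"
  have q: "q n \<in> S" for n
    using from_nat_into[OF \<open>C \<noteq> {}\<close>] C(2) by (auto simp: q_def)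
  have dense: "\<exists>n. d (q n) x < e" if "x \<in> S" "0 < e" for x e
  proof -
    have "x \<in> mtopology closure_of C" using C(3) S(3) that by simp
    then have "\<exists>y\<in>C. d x y < e"
      using \<open>0 < e\<close> unfolding metric_closure_of by auto
    then obtain y where "y \<in> C" "d x y < e" by blast
    then show ?thesis using from_nat_into_surj[OF C(1)] by (metis q_def commute)
  qed
  have q_dist_meas: "(\<lambda>x. d (q n) x < e) \<in> measurable M (count_space UNIV)" for n e
  proof -
    have "{x \<in> space M. d (q n) x < e} = mball (q n) e" using q by (auto simp: space)
    also have "\<dots> \<in> sets M" unfolding T(4) S(3) by (intro sigma_sets.Basic) simp
    finally show ?thesis by (simp add: pred_def)
  qed
  define bits where "bits x j = (case prod_decode j of (k, n) \<Rightarrow> d (q n) x < (1/2) ^ k)" for x j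
  define c where "c x = ternary_code (bits x)" for x
  have "c \<in> borel_measurable M"
  proof -
    have [measurable]: "(\<lambda>x. bits x j) \<in> measurable M (count_space UNIV)" for j
      by (cases "prod_decode j") (simp add: bits_def q_dist_meas)
    show ?thesis unfolding c_def[abs_def] ternary_code_def by measurable
  qed
  define digit where "digit r j \<longleftrightarrow> \<lfloor>r * 3 ^ Suc j\<rfloor> mod 3 = (1::int)" for r :: real and j
  have digit: "digit (c x) j \<longleftrightarrow> bits x j" for x j
    unfolding digit_def c_def ternary_digit by simp
  have [measurable]: "(\<lambda>r. digit r j) \<in> measurable borel (count_space UNIV)" for j
    unfolding digit_def by measurable
  define s where "s r k = q (LEAST n. digit r (prod_encode (k, n)))" for r k
  have s_in: "s r k \<in> S" for r k by (simp add: s_def q)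
  have s_meas: "(\<lambda>r. f (s r k)) \<in> borel_measurable borel" for f :: "_ \<Rightarrow> real" and k
  proof -
    have "(\<lambda>n. f (q n)) \<circ> (\<lambda>r. LEAST n. digit r (prod_encode (k, n))) \<in> borel_measurable borel"
      by (rule measurable_comp) measurable
    then show ?thesis by (simp add: s_def o_def)
  qed
  have s_c: "d (s (c x) k) x < (1/2) ^ k" if "x \<in> S" for x k
  proof -
    have "\<exists>n. d (q n) x < (1/2) ^ k" using dense[OF that] by simp
    then have "d (q (LEAST n. d (q n) x < (1/2) ^ k)) x < (1/2) ^ k" by (rule LeastI_ex)
    then show ?thesis unfolding s_def digit bits_def by simp
  qed
  have s_dist_meas [measurable]: "(\<lambda>r. d (s r k) (s r l)) \<in> borel_measurable borel" for k l
  proof -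
    have "(\<lambda>r. d (q (LEAST n. digit r (prod_encode (k, n)))) (s r l)) \<in> borel_measurable borel"
      by (rule measurable_compose_countable[of "\<lambda>n r. d (q n) (s r l)"]) (use s_meas in measurable)
    then show ?thesis by (simp add: s_def)
  qed
  \<comment> \<open>Restricting the tolerances to a sequence leaves only countable quantifiers, from
    which measurability follows.\<close>
  have Cauchy_iff: "MCauchy (s r) \<longleftrightarrow> (\<forall>m. \<exists>N. \<forall>n n'. N \<le> n \<longrightarrow> N \<le> n' \<longrightarrow> d (s r n) (s r n') < inverse (real (Suc m)))" for r
  proof
    assume "MCauchy (s r)"
    then show "\<forall>m. \<exists>N. \<forall>n n'. N \<le> n \<longrightarrow> N \<le> n' \<longrightarrow> d (s r n) (s r n') < inverse (real (Suc m))"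
      unfolding MCauchy_def by simp
  next
    assume *: "\<forall>m. \<exists>N. \<forall>n n'. N \<le> n \<longrightarrow> N \<le> n' \<longrightarrow> d (s r n) (s r n') < inverse (real (Suc m))"
    show "MCauchy (s r)"
      unfolding MCauchy_def
    proof (intro conjI allI impI)
      fix e :: real assume "0 < e"
      then obtain m where m: "inverse (real (Suc m)) < e" using reals_Archimedean by blast
      obtain N where "\<forall>n n'. N \<le> n \<longrightarrow> N \<le> n' \<longrightarrow> d (s r n) (s r n') < inverse (real (Suc m))"
        using * by blast
      then show "\<exists>N. \<forall>n n'. N \<le> n \<longrightarrow> N \<le> n' \<longrightarrow> d (s r n) (s r n') < e"
        using m less_trans by blast
    qed (use s_in in auto)
  qed
  have Cauchy_meas [measurable]: "(\<lambda>r. MCauchy (s r)) \<in> measurable borel (count_space UNIV)"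
    unfolding Cauchy_iff by measurable
  obtain x0 where "x0 \<in> S" using assms(2) space by blast
  \<comment> \<open>Reals that are not codes may give non-Cauchy sequences; the default
    \<open>x0\<close> keeps the values in the space.\<close>
  define dec where "dec r = (if MCauchy (s r) then SOME l. limitin mtopology (s r) l sequentially else x0)" for r
  have dec_lim: "limitin mtopology (s r) (dec r) sequentially" if "MCauchy (s r)" for r
  proof -
    have "\<exists>l. limitin mtopology (s r) l sequentially"
      using S(2) that unfolding mcomplete_def by blast
    then have "limitin mtopology (s r) (SOME l. limitin mtopology (s r) l sequentially) sequentially"
      by (rule someI_ex)
    then show ?thesis using that by (simp add: dec_def)
  qed
  have dec_in: "dec r \<in> S" for r
    using dec_lim[of r] \<open>x0 \<in> S\<close> by (cases "MCauchy (s r)") (auto simp: limitin_metric dec_def)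
  have dec_dist_meas: "(\<lambda>r. d (dec r) y) \<in> borel_measurable borel" if "y \<in> S" for y
  proof (rule borel_measurable_LIMSEQ_real)
    show "(\<lambda>r. if MCauchy (s r) then d (s r k) y else d x0 y) \<in> borel_measurable borel" for k
      using s_meas by measurable
    show "(\<lambda>k. if MCauchy (s r) then d (s r k) y else d x0 y) \<longlonglongrightarrow> d (dec r) y" for r
    proof (cases "MCauchy (s r)")
      case True
      then have *: "(\<lambda>k. d (s r k) (dec r)) \<longlonglongrightarrow> 0"
        using dec_lim unfolding limitin_metric_dist_null by blast
      have "\<bar>d (s r k) y - d (dec r) y\<bar> \<le> d (s r k) (dec r)" for k
        using triangle[OF s_in[of r k] dec_in[of r] that] triangle[OF dec_in[of r] s_in[of r k] that]
        by (simp add: commute abs_le_iff)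
      then have "(\<lambda>k. d (s r k) y - d (dec r) y) \<longlonglongrightarrow> 0"
        by (intro Lim_null_comparison[OF _ *]) simp
      then show ?thesis using True by (simp add: LIM_zero_iff)
    qed (simp add: dec_def)
  qed
  \<comment> \<open>A countable base: preimages of open sets reduce to countable unions of preimages
    of balls about points \<open>q n\<close>, which are described by measurable distances.\<close>
  have ball_union: "U = (\<Union>(n, i)\<in>{(n, i). mball (q n) (inverse (real (Suc i))) \<subseteq> U}. mball (q n) (inverse (real (Suc i))))"
    if "openin T U" for U
  proof (intro equalityI subsetI)
    fix x assume "x \<in> U"
    then obtain e where e: "0 < e" "mball x e \<subseteq> U" and "x \<in> S"
      using \<open>openin T U\<close> unfolding S(3) openin_mtopology by blast
    obtain i where i: "inverse (real (Suc i)) < e / 2" using reals_Archimedean[of "e/2"] e(1) by auto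
    obtain n where n: "d (q n) x < inverse (real (Suc i))"
      using dense[OF \<open>x \<in> S\<close>, of "inverse (real (Suc i))"] by auto
    have "mball (q n) (inverse (real (Suc i))) \<subseteq> mball x e"
    proof
      fix y assume y: "y \<in> mball (q n) (inverse (real (Suc i)))"
      then have "d x y \<le> d x (q n) + d (q n) y" using triangle[OF \<open>x \<in> S\<close> q, of y n] by simp
      also have "\<dots> < e" using i n y commute[of x "q n"] by simp
      finally show "y \<in> mball x e" using y \<open>x \<in> S\<close> by simp
    qed
    then show "x \<in> (\<Union>(n, i)\<in>{(n, i). mball (q n) (inverse (real (Suc i))) \<subseteq> U}. mball (q n) (inverse (real (Suc i))))"
      using e(2) n q \<open>x \<in> S\<close> by (intro UN_I[of "(n, i)"]) auto
  qed auto
  have "dec \<in> borel \<rightarrow>\<^sub>M M"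
  proof (rule measurable_sigma_sets[OF T(4)])
    show "{U. openin T U} \<subseteq> Pow (space M)" using T(1) openin_subset by blast
    show "dec \<in> space borel \<rightarrow> space M" using dec_in space by simp
    fix U assume "U \<in> {U. openin T U}"
    then have U: "U = (\<Union>(n, i)\<in>{(n, i). mball (q n) (inverse (real (Suc i))) \<subseteq> U}. mball (q n) (inverse (real (Suc i))))"
      using ball_union by blast
    have "dec -` mball (q n) e = {r \<in> space borel. d (dec r) (q n) < e}" for n e
      using q dec_in by (auto simp: commute)
    moreover have "{r \<in> space borel. d (dec r) (q n) < e} \<in> sets borel" for n e
      using dec_dist_meas[OF q] by measurable
    ultimately have "dec -` mball (q n) e \<in> sets borel" for n e by simp
    then show "dec -` U \<inter> space borel \<in> sets borel"
      by (subst U) (auto simp: vimage_UN split_beta intro!: sets.countable_UN'')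
  qed
  moreover have "dec (c x) = x" if "x \<in> space M" for x
  proof -
    have "x \<in> S" using that space by simp
    have "(\<lambda>k. d (s (c x) k) x) \<longlonglongrightarrow> 0"
    proof (rule Lim_null_comparison)
      show "\<forall>\<^sub>F k in sequentially. norm (d (s (c x) k) x) \<le> (1/2) ^ k"
        using s_c[OF \<open>x \<in> S\<close>] by (intro always_eventually) (simp add: less_imp_le)
      show "(\<lambda>k. (1/2 :: real) ^ k) \<longlonglongrightarrow> 0" by (intro LIMSEQ_realpow_zero) auto
    qed
    then have lim: "limitin mtopology (s (c x)) x sequentially"
      unfolding limitin_metric_dist_null using s_in \<open>x \<in> S\<close> by simp
    then have "MCauchy (s (c x))"
      using convergent_imp_MCauchy s_in by blast
    then show ?thesis
      using limitin_metric_unique[OF dec_lim lim] by simp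
  qed
  ultimately show ?thesis using that \<open>c \<in> borel_measurable M\<close> by blast
qed

section \<open>Almost everywhere isomorphism with the unit interval\<close>

abbreviation unit_lborel :: "real measure" where
  "unit_lborel \<equiv> restrict_space lborel {0<..<1}"

text \<open>Living on all of the Borel line lets everywhere defined real functions act on it
  directly.\<close>

definition unit_uniform :: "real measure" where
  "unit_uniform = distr unit_lborel borel (\<lambda>u. u)"

lemma measurable_unit_lborel: "f \<in> borel \<rightarrow>\<^sub>M K \<Longrightarrow> f \<in> unit_lborel \<rightarrow>\<^sub>M K"
  by (intro measurable_restrict_space1) simp

lemma space_unit_uniform [simp]: "space unit_uniform = UNIV"
  and sets_unit_uniform [simp, measurable_cong]: "sets unit_uniform = sets borel"
  by (simp_all add: unit_uniform_def)

lemma distr_unit_uniform: "f \<in> borel \<rightarrow>\<^sub>M K \<Longrightarrow> distr unit_uniform K f = distr unit_lborel K f"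
  unfolding unit_uniform_def by (subst distr_distr) (auto simp: o_def intro: measurable_unit_lborel)

lemma prob_space_unit_uniform: "prob_space unit_uniform"
proof -
  interpret prob_space unit_lborel
    by (rule prob_spaceI) (simp add: space_restrict_space emeasure_restrict_space)
  show ?thesis unfolding unit_uniform_def
    by (intro prob_space_distr measurable_unit_lborel) simp
qed

lemma AE_unit_uniform: "AE u in unit_uniform. 0 < u \<and> u < 1"
  unfolding unit_uniform_def
  by (subst AE_distr_iff) (auto intro: measurable_unit_lborel simp: space_restrict_space)

text \<open>Only an atom at \<open>I u\<close> would let the distribution function jump past
  \<open>u\<close>: to the left of \<open>I u\<close> its values are at most \<open>u\<close>, and
  continuity passes this to the limit.\<close>

lemma (in cdf_distribution) cdf_pseudoinverse:
  assumes "measure M {I u} = 0" and "0 < u" "u < 1"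
  shows "C (I u) = u"
proof (rule antisym)
  show "u \<le> C (I u)" using pseudoinverse[OF assms(2,3), of "I u"] by simp
  have "isCont C (I u)" using assms(1) isCont_cdf by (metis)
  then have "(C \<longlongrightarrow> C (I u)) (at_left (I u))"
    unfolding isCont_def filterlim_at_split by (rule conjunct1)
  moreover have "\<forall>\<^sub>F x in at_left (I u). C x \<le> u"
  proof (rule eventually_at_leftI[of "I u - 1"])
    fix x assume "x \<in> {I u - 1<..<I u}"
    then have "\<not> I u \<le> x" by simp
    then show "C x \<le> u" using pseudoinverse[OF assms(2,3), of x] by simp
  qed simp
  ultimately show "C (I u) \<le> u"
    by (rule tendsto_upperbound) simp
qed

lemma nonatomic_singleton:
  assumes "nonatomic M" and "A \<in> sets M" "A \<subseteq> {x}"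
  shows "emeasure M A = 0"
proof (rule ccontr)
  assume "emeasure M A \<noteq> 0"
  then obtain B where "B \<subseteq> A" "0 < emeasure M B" "emeasure M B < emeasure M A"
    using assms(1,2) unfolding nonatomic_def by (metis zero_less_iff_neq_zero)
  moreover from this have "B = {} \<or> B = A" using assms(3) by blast
  ultimately show False by auto
qed

text \<open>The law \<open>N\<close> of \<open>c\<close> has no atoms, because the preimage of a
  real under \<open>c\<close> has at most one point. Its distribution function after
  \<open>c\<close>, and \<open>dec\<close> after its quantile function, are then inverse almost
  everywhere.\<close>

lemma unit_interval_model:
  assumes "standard_prob_space M"
  obtains c :: "'x \<Rightarrow> real" and dec :: "real \<Rightarrow> 'x" and \<phi> :: "'x \<Rightarrow> real" and \<psi> :: "real \<Rightarrow> 'x"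
  where "c \<in> borel_measurable M" "dec \<in> borel \<rightarrow>\<^sub>M M" "\<And>x. x \<in> space M \<Longrightarrow> dec (c x) = x"
    and "\<phi> \<in> borel_measurable M" "\<psi> \<in> borel \<rightarrow>\<^sub>M M"
    and "distr unit_uniform M \<psi> = M" "distr M borel \<phi> = unit_uniform"
    and "AE u in unit_uniform. \<phi> (\<psi> u) = u" "AE x in M. 0 < \<phi> x \<and> \<phi> x < 1 \<and> \<psi> (\<phi> x) = x"
proof -
  interpret prob_space M using assms by (simp add: standard_prob_space_def)
  have "standard_borel_space M" and "nonatomic M"
    using assms by (simp_all add: standard_prob_space_def)
  obtain c :: "'x \<Rightarrow> real" and dec where c [measurable]: "c \<in> borel_measurable M"
    and dec [measurable]: "dec \<in> borel \<rightarrow>\<^sub>M M" and dec_c: "\<And>x. x \<in> space M \<Longrightarrow> dec (c x) = x"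
    using standard_borel_embedding[OF \<open>standard_borel_space M\<close> not_empty] by blast
  define N where "N = distr M borel c"
  have [measurable_cong, simp]: "sets N = sets borel" by (simp add: N_def)
  interpret N: cdf_distribution N
    unfolding cdf_distribution_def real_distribution_def real_distribution_axioms_def N_def
    by (simp add: prob_space_distr)
  have "measure N {r} = 0" for r
  proof -
    have "emeasure N {r} = emeasure M (c -` {r} \<inter> space M)"
      unfolding N_def by (rule emeasure_distr) auto
    also have "c -` {r} \<inter> space M \<subseteq> {dec r}" using dec_c by auto
    then have "emeasure M (c -` {r} \<inter> space M) = 0"
      by (intro nonatomic_singleton[OF \<open>nonatomic M\<close>]) auto
    finally show ?thesis by (simp add: measure_def)
  qed
  then have cdf_I: "cdf N (N.I u) = u" if "0 < u" "u < 1" for u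
    using N.cdf_pseudoinverse that by blast
  have N_dec: "distr N M dec = M"
  proof -
    have "distr N M dec = distr M M (dec \<circ> c)" unfolding N_def by (rule distr_distr) auto
    also have "\<dots> = distr M M (\<lambda>x. x)" using dec_c by (intro distr_cong) auto
    finally show ?thesis by (simp add: distr_id2)
  qed
  have AE_N: "AE r in N. c (dec r) = r"
    unfolding N_def by (subst AE_distr_iff) (auto simp: dec_c)
  \<comment> \<open>The quantile function is meaningful on the open unit interval only; the value 0
    elsewhere affects a null set.\<close>
  define J where "J u = (if u \<in> {0<..<1} then N.I u else 0)" for u
  have J [measurable]: "J \<in> borel_measurable borel"
    unfolding J_def[abs_def]
  proof (rule measurable_If_restrict_space_iff[THEN iffD2])
    have "{u \<in> space borel. u \<in> {0<..<1}} = {0<..<1::real}" by auto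
    then show "N.I \<in> borel_measurable (restrict_space borel {u. u \<in> {0<..<1}}) \<and>
        (\<lambda>u. 0 :: real) \<in> borel_measurable (restrict_space borel {u. u \<notin> {0<..<1::real}})"
      using N.measurable_CI by simp
  qed simp
  have unit_J: "distr unit_uniform borel J = N"
  proof -
    have "distr unit_uniform borel J = distr unit_lborel borel N.I"
      by (subst distr_unit_uniform[OF J]) (auto simp: J_def space_restrict_space intro!: distr_cong)
    then show ?thesis using N.distr_I_eq_M by simp
  qed
  define \<phi> where "\<phi> x = cdf N (c x)" for x
  define \<psi> where "\<psi> u = dec (J u)" for u
  have \<phi> [measurable]: "\<phi> \<in> borel_measurable M" unfolding \<phi>_def by measurable
  have \<psi> [measurable]: "\<psi> \<in> borel \<rightarrow>\<^sub>M M" unfolding \<psi>_def by measurable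
  have unit_\<psi>: "distr unit_uniform M \<psi> = M"
  proof -
    have "distr N M dec = distr unit_uniform M (dec \<circ> J)"
      unfolding unit_J[symmetric] by (rule distr_distr) auto
    moreover have "dec \<circ> J = \<psi>" by (auto simp: \<psi>_def)
    ultimately show ?thesis by (simp only: N_dec)
  qed
  have AE_unit: "AE u in unit_uniform. \<phi> (\<psi> u) = u"
  proof -
    have "AE r in distr unit_uniform borel J. c (dec r) = r"
      using AE_N by (simp only: unit_J)
    then have "AE u in unit_uniform. c (dec (J u)) = J u"
      by (rule AE_distrD[rotated]) simp
    then show ?thesis
      using AE_unit_uniform
    proof eventually_elim
      case (elim u)
      then show ?case using cdf_I[of u] by (simp add: \<phi>_def \<psi>_def J_def)
    qed
  qed
  moreover have "distr M borel \<phi> = unit_uniform"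
  proof -
    have "distr M borel \<phi> = distr unit_uniform borel (\<phi> \<circ> \<psi>)"
      using distr_distr[of \<phi> M borel \<psi> unit_uniform] unit_\<psi> by simp
    also have "\<dots> = distr unit_uniform unit_uniform (\<lambda>u. u)"
      using AE_unit by (intro distr_cong_AE) auto
    finally show ?thesis by (simp add: distr_id2)
  qed
  moreover have "AE x in M. 0 < \<phi> x \<and> \<phi> x < 1 \<and> \<psi> (\<phi> x) = x"
  proof -
    \<comment> \<open>Equality of points is tested through \<open>c\<close>, which makes it a
      measurable condition that can be transferred along \<open>\<psi>\<close>.\<close>
    have "AE u in unit_uniform. 0 < \<phi> (\<psi> u) \<and> \<phi> (\<psi> u) < 1 \<and> c (\<psi> (\<phi> (\<psi> u))) = c (\<psi> u)"
      using AE_unit AE_unit_uniform by eventually_elim simp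
    then have "AE x in distr unit_uniform M \<psi>. 0 < \<phi> x \<and> \<phi> x < 1 \<and> c (\<psi> (\<phi> x)) = c x"
      by (subst AE_distr_iff) auto
    then have "AE x in M. 0 < \<phi> x \<and> \<phi> x < 1 \<and> c (\<psi> (\<phi> x)) = c x" by (simp only: unit_\<psi>)
    then show ?thesis
    proof (rule AE_mp, intro AE_I2 impI conjI)
      fix x assume "x \<in> space M" and *: "0 < \<phi> x \<and> \<phi> x < 1 \<and> c (\<psi> (\<phi> x)) = c x"
      moreover have "\<psi> (\<phi> x) \<in> space M" using measurable_space[OF \<psi>] by simp
      ultimately show "\<psi> (\<phi> x) = x" using dec_c by metis
    qed auto
  qed
  ultimately show ?thesis using that c dec dec_c \<phi> \<psi> unit_\<psi> by blast
qed

section \<open>Circle reflections and the automorphisms they induce\<close>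

text \<open>The reflection \<open>u \<mapsto> t - u\<close> of the circle \<open>\<real>/\<int>\<close>. A reflection is used instead of the
  rotation by \<open>t\<close> because it is an involution: transported along an isomorphism defined almost
  everywhere, it becomes a bijection after a single restriction to the points where both it and the
  isomorphism behave well. The fixed value at \<open>u = t\<close> keeps it inside the open interval.\<close>

definition circle_reflection :: "real \<Rightarrow> real \<Rightarrow> real" where
  "circle_reflection t u = (if u < t then t - u else if u = t then t else t - u + 1)"

lemma circle_reflection_unit:
  assumes "u \<in> {0<..<1}" "t \<in> {0<..<1}"
  shows "circle_reflection t u \<in> {0<..<1}" and "circle_reflection t (circle_reflection t u) = u"
  using assms by (auto simp: circle_reflection_def)

lemma measurable_circle_reflection [measurable]:
  "(\<lambda>(t, u). circle_reflection t u) \<in> borel_measurable (borel \<Otimes>\<^sub>M borel)"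
  unfolding circle_reflection_def case_prod_beta by measurable

text \<open>Each of the intervals from 0 to \<open>t\<close> and from \<open>t\<close> to 1 is
  mapped onto itself with slope -1, and the point \<open>t\<close> is null.\<close>

lemma distr_circle_reflection:
  assumes t: "t \<in> {0<..<1}"
  shows "distr unit_uniform borel (circle_reflection t) = unit_uniform"
proof -
  have [measurable]: "circle_reflection t \<in> borel_measurable borel"
    using measurable_compose[OF measurable_Pair1' measurable_circle_reflection, of t] by simp
  have "distr unit_lborel borel (circle_reflection t) = distr unit_lborel borel (\<lambda>u. u)"
  proof (rule measure_eqI)
    fix A assume "A \<in> sets (distr unit_lborel borel (circle_reflection t))"
    then have [measurable]: "A \<in> sets borel" by simp
    let ?a = "indicator (A \<inter> {0<..<t}) :: real \<Rightarrow> ennreal" and ?b = "indicator (A \<inter> {t<..<1}) :: real \<Rightarrow> ennreal"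
    have "emeasure (distr unit_lborel borel (circle_reflection t)) A
        = emeasure lborel ({u. circle_reflection t u \<in> A} \<inter> {0<..<1})"
      by (subst emeasure_distr)
         (auto simp: measurable_unit_lborel space_restrict_space emeasure_restrict_space vimage_def intro!: arg_cong[where f="emeasure lborel"])
    also have "\<dots> = (\<integral>\<^sup>+u. indicator ({u. circle_reflection t u \<in> A} \<inter> {0<..<1}) u \<partial>lborel)"
      by (rule nn_integral_indicator[symmetric]) measurable
    also have "\<dots> = (\<integral>\<^sup>+u. ?a (t + (-1) * u) + ?b (t + 1 + (-1) * u) \<partial>lborel)"
      using AE_lborel_singleton[of t] t
      by (intro nn_integral_cong_AE) (auto split: split_indicator simp: circle_reflection_def algebra_simps)
    also have "\<dots> = (\<integral>\<^sup>+u. ?a (t + (-1) * u) \<partial>lborel) + (\<integral>\<^sup>+u. ?b (t + 1 + (-1) * u) \<partial>lborel)"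
      by (rule nn_integral_add) measurable
    also have "(\<integral>\<^sup>+u. ?a (t + (-1) * u) \<partial>lborel) = (\<integral>\<^sup>+u. ?a u \<partial>lborel)"
      using nn_integral_real_affine[of ?a "-1" t] by simp
    also have "(\<integral>\<^sup>+u. ?b (t + 1 + (-1) * u) \<partial>lborel) = (\<integral>\<^sup>+u. ?b u \<partial>lborel)"
      using nn_integral_real_affine[of ?b "-1" "t + 1"] by simp
    also have "(\<integral>\<^sup>+u. ?a u \<partial>lborel) + (\<integral>\<^sup>+u. ?b u \<partial>lborel) = (\<integral>\<^sup>+u. ?a u + ?b u \<partial>lborel)"
      by (rule nn_integral_add[symmetric]) measurable
    also have "\<dots> = (\<integral>\<^sup>+u. indicator (A \<inter> {0<..<1}) u \<partial>lborel)"
      using AE_lborel_singleton[of t] t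
      by (intro nn_integral_cong_AE) (auto split: split_indicator)
    also have "\<dots> = emeasure lborel (A \<inter> {0<..<1})"
      by (rule nn_integral_indicator) measurable
    also have "\<dots> = emeasure (distr unit_lborel borel (\<lambda>u. u)) A"
      by (subst emeasure_distr)
         (auto simp: measurable_unit_lborel space_restrict_space emeasure_restrict_space intro!: arg_cong[where f="emeasure lborel"])
    finally show "emeasure (distr unit_lborel borel (circle_reflection t)) A
        = emeasure (distr unit_lborel borel (\<lambda>u. u)) A" .
  qed simp
  then show ?thesis by (subst distr_unit_uniform) (simp_all add: unit_uniform_def)
qed

text \<open>In the variable \<open>t\<close> the map is a circle translation: values above
  \<open>u\<close> move down by \<open>u\<close>, values below move up by \<open>1 - u\<close>.
  Averaging over \<open>t\<close> thus spreads any fixed point uniformly.\<close>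

lemma distr_circle_reflection_centre:
  assumes u: "u \<in> {0<..<1}"
  shows "distr unit_uniform borel (\<lambda>t. circle_reflection t u) = unit_uniform"
proof -
  have [measurable]: "(\<lambda>t. circle_reflection t u) \<in> borel_measurable borel"
    using measurable_compose[OF measurable_Pair2' measurable_circle_reflection, of u] by simp
  have "distr unit_lborel borel (\<lambda>t. circle_reflection t u) = distr unit_lborel borel (\<lambda>u. u)"
  proof (rule measure_eqI)
    fix A assume "A \<in> sets (distr unit_lborel borel (\<lambda>t. circle_reflection t u))"
    then have [measurable]: "A \<in> sets borel" by simp
    let ?a = "indicator (A \<inter> {0<..<1-u}) :: real \<Rightarrow> ennreal" and ?b = "indicator (A \<inter> {1-u<..<1}) :: real \<Rightarrow> ennreal"
    have "emeasure (distr unit_lborel borel (\<lambda>t. circle_reflection t u)) A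
        = emeasure lborel ({t. circle_reflection t u \<in> A} \<inter> {0<..<1})"
      by (subst emeasure_distr)
         (auto simp: measurable_unit_lborel space_restrict_space emeasure_restrict_space vimage_def intro!: arg_cong[where f="emeasure lborel"])
    also have "\<dots> = (\<integral>\<^sup>+t. indicator ({t. circle_reflection t u \<in> A} \<inter> {0<..<1}) t \<partial>lborel)"
      by (rule nn_integral_indicator[symmetric]) measurable
    also have "\<dots> = (\<integral>\<^sup>+t. ?a (- u + 1 * t) + ?b (1 - u + 1 * t) \<partial>lborel)"
      using AE_lborel_singleton[of u] u
      by (intro nn_integral_cong_AE) (auto split: split_indicator simp: circle_reflection_def algebra_simps)
    also have "\<dots> = (\<integral>\<^sup>+t. ?a (- u + 1 * t) \<partial>lborel) + (\<integral>\<^sup>+t. ?b (1 - u + 1 * t) \<partial>lborel)"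
      by (rule nn_integral_add) measurable
    also have "(\<integral>\<^sup>+t. ?a (- u + 1 * t) \<partial>lborel) = (\<integral>\<^sup>+t. ?a t \<partial>lborel)"
      using nn_integral_real_affine[of ?a 1 "- u"] by simp
    also have "(\<integral>\<^sup>+t. ?b (1 - u + 1 * t) \<partial>lborel) = (\<integral>\<^sup>+t. ?b t \<partial>lborel)"
      using nn_integral_real_affine[of ?b 1 "1 - u"] by simp
    also have "(\<integral>\<^sup>+t. ?a t \<partial>lborel) + (\<integral>\<^sup>+t. ?b t \<partial>lborel) = (\<integral>\<^sup>+t. ?a t + ?b t \<partial>lborel)"
      by (rule nn_integral_add[symmetric]) measurable
    also have "\<dots> = (\<integral>\<^sup>+t. indicator (A \<inter> {0<..<1}) t \<partial>lborel)"
      using AE_lborel_singleton[of "1 - u"] u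
      by (intro nn_integral_cong_AE) (auto split: split_indicator)
    also have "\<dots> = emeasure lborel (A \<inter> {0<..<1})"
      by (rule nn_integral_indicator) measurable
    also have "\<dots> = emeasure (distr unit_lborel borel (\<lambda>u. u)) A"
      by (subst emeasure_distr)
         (auto simp: measurable_unit_lborel space_restrict_space emeasure_restrict_space intro!: arg_cong[where f="emeasure lborel"])
    finally show "emeasure (distr unit_lborel borel (\<lambda>t. circle_reflection t u)) A
        = emeasure (distr unit_lborel borel (\<lambda>u. u)) A" .
  qed simp
  then show ?thesis by (subst distr_unit_uniform) (simp_all add: unit_uniform_def)
qed

lemma reflection_mp_bijection:
  fixes c :: "'x \<Rightarrow> real"
  assumes [measurable]: "c \<in> borel_measurable M" and inj: "inj_on c (space M)"
    and [measurable]: "\<phi> \<in> borel_measurable M" "\<psi> \<in> borel \<rightarrow>\<^sub>M M"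
    and unit_\<psi>: "distr unit_uniform M \<psi> = M" and \<phi>_unit: "distr M borel \<phi> = unit_uniform"
    and AE_unit: "AE u in unit_uniform. \<phi> (\<psi> u) = u"
    and AE_M: "AE x in M. 0 < \<phi> x \<and> \<phi> x < 1 \<and> \<psi> (\<phi> x) = x"
    and t: "t \<in> {0<..<1}"
  obtains T where "T \<in> mp_bijections M" "AE x in M. T x = \<psi> (circle_reflection t (\<phi> x))"
proof -
  let ?\<rho> = "circle_reflection t"
  have \<rho> [measurable]: "?\<rho> \<in> borel_measurable borel"
    using measurable_compose[OF measurable_Pair1' measurable_circle_reflection, of t] by simp
  have \<psi>_space: "\<psi> u \<in> space M" for u
    using measurable_space[OF assms(4)] by simp
  \<comment> \<open>The model is required to be invertible both at the point and at its reflected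
    image. This condition is symmetric under the reflection, so \<open>T\<close> permutes the good
    points and fixes the others.\<close>
  define good where "good x \<longleftrightarrow> 0 < \<phi> x \<and> \<phi> x < 1 \<and> \<psi> (\<phi> x) = x \<and> \<phi> (\<psi> (?\<rho> (\<phi> x))) = ?\<rho> (\<phi> x)" for x
  have good_alt: "good x \<longleftrightarrow> 0 < \<phi> x \<and> \<phi> x < 1 \<and> c (\<psi> (\<phi> x)) = c x \<and> \<phi> (\<psi> (?\<rho> (\<phi> x))) = ?\<rho> (\<phi> x)"
    if "x \<in> space M" for x
    using inj_onD[OF inj _ \<psi>_space that] by (auto simp: good_def)
  have [measurable]: "Measurable.pred M good"
    by (subst measurable_cong[OF good_alt]) measurable
  define T where "T x = (if good x then \<psi> (?\<rho> (\<phi> x)) else x)" for x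
  have T_meas [measurable]: "T \<in> M \<rightarrow>\<^sub>M M" unfolding T_def by measurable
  have T_invol: "T (T x) = x" for x
  proof (cases "good x")
    case True
    let ?v = "?\<rho> (\<phi> x)"
    have u: "\<phi> x \<in> {0<..<1}" and fix_x: "\<psi> (\<phi> x) = x" and fix_v: "\<phi> (\<psi> ?v) = ?v"
      using True by (auto simp: good_def)
    have "?v \<in> {0<..<1}" "?\<rho> ?v = \<phi> x" using circle_reflection_unit[OF u t] .
    then have "good (\<psi> ?v)" by (simp add: good_def fix_x fix_v)
    then show ?thesis using True \<open>?\<rho> ?v = \<phi> x\<close> by (simp add: T_def fix_x fix_v)
  qed (simp add: T_def)
  have "AE x in M. \<phi> (\<psi> (?\<rho> (\<phi> x))) = ?\<rho> (\<phi> x)"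
  proof -
    have "AE v in distr unit_uniform borel ?\<rho>. \<phi> (\<psi> v) = v"
      using AE_unit by (simp only: distr_circle_reflection[OF t])
    then have "AE u in unit_uniform. \<phi> (\<psi> (?\<rho> u)) = ?\<rho> u"
      by (rule AE_distrD[rotated]) simp
    then have "AE u in distr M borel \<phi>. \<phi> (\<psi> (?\<rho> u)) = ?\<rho> u"
      by (simp only: \<phi>_unit)
    then show ?thesis by (rule AE_distrD[rotated]) simp
  qed
  then have T_AE: "AE x in M. T x = \<psi> (?\<rho> (\<phi> x))"
    using AE_M by eventually_elim (simp add: T_def good_def)
  have "distr M M T = M"
  proof -
    have "distr M M T = distr M M ((\<psi> \<circ> ?\<rho>) \<circ> \<phi>)"
      using T_AE by (intro distr_cong_AE) auto
    also have "\<dots> = distr unit_uniform M (\<psi> \<circ> ?\<rho>)"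
      unfolding \<phi>_unit[symmetric] by (rule distr_distr[symmetric]) auto
    also have "\<dots> = distr (distr unit_uniform borel ?\<rho>) M \<psi>"
      by (rule distr_distr[symmetric]) auto
    finally show ?thesis by (simp only: distr_circle_reflection[OF t] unit_\<psi>)
  qed
  moreover have "bij_betw T (space M) (space M)"
    using measurable_space[OF T_meas] T_invol
    by (intro bij_betw_byWitness[where f' = T]) auto
  ultimately have "T \<in> mp_bijections M" using T_meas by (simp add: mp_bijections_def)
  then show ?thesis using T_AE by (rule that)
qed

text \<open>The exceptional set of \<open>x\<close> varies with \<open>t\<close>. Exchanging
  quantifiers by Fubini fixes almost every \<open>x\<close> first; its reflected images then have
  law \<open>M\<close> as \<open>t\<close> varies, so almost every \<open>y\<close> is
  reached.\<close>

lemma AE_pair_if_AE_reflections: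
  assumes "prob_space M"
    and [measurable]: "\<phi> \<in> borel_measurable M" "\<psi> \<in> borel \<rightarrow>\<^sub>M M"
    and unit_\<psi>: "distr unit_uniform M \<psi> = M"
    and AE_M: "AE x in M. 0 < \<phi> x \<and> \<phi> x < 1"
    and [measurable]: "H \<in> sets (M \<Otimes>\<^sub>M M)"
    and refl: "\<And>t. t \<in> {0<..<1} \<Longrightarrow> AE x in M. (x, \<psi> (circle_reflection t (\<phi> x))) \<in> H"
  shows "AE p in M \<Otimes>\<^sub>M M. p \<in> H"
proof -
  interpret M: prob_space M by fact
  interpret U: prob_space unit_uniform by (rule prob_space_unit_uniform)
  interpret UM: pair_sigma_finite unit_uniform M ..
  interpret MM: pair_sigma_finite M M ..
  note measurable_circle_reflection [measurable]
  have [measurable]: "(\<lambda>(t, x). circle_reflection t (\<phi> x)) \<in> borel_measurable (unit_uniform \<Otimes>\<^sub>M M)"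
    using measurable_compose[OF _ measurable_circle_reflection, of "\<lambda>(t, x). (t, \<phi> x)"] by (simp add: split_beta)
  have "AE t in unit_uniform. AE x in M. (x, \<psi> (circle_reflection t (\<phi> x))) \<in> H"
    using AE_unit_uniform by eventually_elim (simp add: refl)
  then have "AE x in M. AE t in unit_uniform. (x, \<psi> (circle_reflection t (\<phi> x))) \<in> H"
    by (subst (asm) UM.AE_commute) measurable
  then have "AE x in M. AE y in M. (x, y) \<in> H"
    using AE_M AE_space
  proof eventually_elim
    case (elim x)
    have [measurable]: "(\<lambda>t. circle_reflection t (\<phi> x)) \<in> borel_measurable borel"
      using measurable_compose[OF measurable_Pair2' measurable_circle_reflection, of "\<phi> x"] by simp
    have "distr unit_uniform M (\<psi> \<circ> (\<lambda>t. circle_reflection t (\<phi> x)))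
        = distr (distr unit_uniform borel (\<lambda>t. circle_reflection t (\<phi> x))) M \<psi>"
      by (rule distr_distr[symmetric]) auto
    also have "\<dots> = M"
      using distr_circle_reflection_centre[of "\<phi> x"] elim(2) unit_\<psi> by simp
    finally have "distr unit_uniform M (\<lambda>t. \<psi> (circle_reflection t (\<phi> x))) = M" by (simp add: o_def)
    moreover have "AE y in distr unit_uniform M (\<lambda>t. \<psi> (circle_reflection t (\<phi> x))). (x, y) \<in> H"
      using elim(1,3) by (subst AE_distr_iff) auto
    ultimately show ?case by (simp only:)
  qed
  then show ?thesis by (intro MM.AE_pair_measure) auto
qed

section \<open>From the full group to compactness of the group\<close>

lemma orbit_full_group_AE:
  assumes "orbit_full_group M act = Aut M" and "T \<in> mp_bijections M"
  shows "AE x in M. T x \<in> orbit act x"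
proof -
  have "ae_eq M `` {T} \<in> Aut M" unfolding Aut_def using assms(2) by (rule quotientI)
  then have "ae_eq M `` {T} \<in> orbit_full_group M act" by (simp only: assms(1))
  then have "\<forall>S\<in>ae_eq M `` {T}. AE x in M. S x \<in> orbit act x"
    unfolding orbit_full_group_def mem_Collect_eq by (rule conjunct2)
  moreover have "T \<in> ae_eq M `` {T}" using assms(2) by (simp add: ae_eq_def)
  ultimately show ?thesis by (rule bspec)
qed

text \<open>Two translates of \<open>W\<close> have measure above one half each, so they meet, and freeness at \<open>x\<^sub>0\<close> puts
  every \<open>g\<close> into \<open>K - K\<close>.\<close>

lemma compact_UNIV_if_large_compact_orbit_piece:
  fixes act :: "'g::{topological_group_add,polish_space} \<Rightarrow> 'x \<Rightarrow> 'x"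
  assumes "prob_space M" and "borel_action M act" and "measure_preserving_action M act"
    and x0: "x0 \<in> space M" and free: "\<And>g. act g x0 = x0 \<Longrightarrow> g = 0"
    and "compact K" and W: "W \<in> sets M" "W \<subseteq> (\<lambda>g. act g x0) ` K" "measure M W > 1/2"
  shows "compact (UNIV :: 'g set)"
proof -
  interpret prob_space M by fact
  have act_0: "x \<in> space M \<Longrightarrow> act 0 x = x"
    and act_add: "x \<in> space M \<Longrightarrow> act (g + h) x = act g (act h x)"
    and act_meas: "(\<lambda>(g, x). act g x) \<in> borel \<Otimes>\<^sub>M M \<rightarrow>\<^sub>M M" for g h x
    using assms(2) by (auto simp: borel_action_def)
  have "g \<in> (\<lambda>(k, k'). k - k') ` (K \<times> K)" for g
  proof -
    have [measurable]: "act g \<in> M \<rightarrow>\<^sub>M M"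
      using measurable_compose[OF measurable_Pair1' act_meas, of g] by simp
    have "emeasure M (act g -` W \<inter> space M) = emeasure M W"
      using emeasure_distr[of "act g" M M W] W(1) assms(3) by (simp add: measure_preserving_action_def)
    then have "prob (act g -` W \<inter> space M) = prob W" by (simp add: measure_def)
    \<comment> \<open>A common point is some \<open>k x0\<close> whose translate by \<open>g\<close>
      is again some \<open>k' x0\<close>; then \<open>- k' + (g + k)\<close> fixes
      \<open>x0\<close>.\<close>
    have "W \<inter> (act g -` W \<inter> space M) \<noteq> {}"
    proof
      assume *: "W \<inter> (act g -` W \<inter> space M) = {}"
      have "prob W + prob (act g -` W \<inter> space M) = prob (W \<union> (act g -` W \<inter> space M))"
        using W(1) * by (intro finite_measure_Union[symmetric]) auto
      also have "\<dots> \<le> 1" by (rule prob_le_1)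
      finally show False using W(3) \<open>prob (act g -` W \<inter> space M) = prob W\<close> by simp
    qed
    then obtain k k' where k: "k \<in> K" "k' \<in> K" "act g (act k x0) = act k' x0"
      using W(2) by blast
    have "act (- k' + (g + k)) x0 = act (- k') (act k' x0)"
      by (simp add: act_add x0 k(3))
    also have "\<dots> = x0" using act_add[OF x0, of "- k'" k'] act_0[OF x0] by simp
    finally have "- k' + (g + k) = 0" by (rule free)
    then have "k' + (- k' + (g + k)) = k' + 0" by (rule arg_cong)
    then have "g + k = k'" by (simp only: add_minus_cancel add_0_right)
    then have "g = k' - k" by (simp add: eq_diff_eq)
    then show ?thesis using k by auto
  qed
  then have "UNIV = (\<lambda>(k, k'). k - k') ` (K \<times> K)" by blast
  moreover have "compact ((\<lambda>(k, k'). k - k') ` (K \<times> K))"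
    using \<open>compact K\<close> unfolding split_beta
    by (intro compact_continuous_image compact_Times continuous_intros)
  ultimately show ?thesis by simp
qed

theorem corollary3p24:
  fixes M :: "'x measure"
    and act :: "'g::{topological_group_add,polish_space} \<Rightarrow> 'x \<Rightarrow> 'x"
  assumes "standard_prob_space M"
    and "borel_action M act"
    and "measure_preserving_action M act"
    and "essentially_free M act"
    and "orbit_full_group M act = Aut M"
  shows "compact (UNIV :: 'g set)"
proof -
  interpret M: prob_space M using assms(1) by (simp add: standard_prob_space_def)
  interpret MM: pair_prob_space M M ..
  obtain A where A: "A \<subseteq> space M" "AE x in M. x \<in> A" "\<forall>g. g \<noteq> 0 \<longrightarrow> (\<forall>x\<in>A. act g x \<noteq> x)"
    using assms(4) unfolding essentially_free_def by (elim exE conjE) (rule that)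
  obtain c :: "'x \<Rightarrow> real" and dec \<phi> \<psi> where
    c [measurable]: "c \<in> borel_measurable M" and dec [measurable]: "dec \<in> borel \<rightarrow>\<^sub>M M"
    and dec_c: "\<And>x. x \<in> space M \<Longrightarrow> dec (c x) = x"
    and model: "\<phi> \<in> borel_measurable M" "\<psi> \<in> borel \<rightarrow>\<^sub>M M"
      "distr unit_uniform M \<psi> = M" "distr M borel \<phi> = unit_uniform"
      "AE u in unit_uniform. \<phi> (\<psi> u) = u" "AE x in M. 0 < \<phi> x \<and> \<phi> x < 1 \<and> \<psi> (\<phi> x) = x"
    by (rule unit_interval_model[OF assms(1)]) (rule that)
  have inj: "inj_on c (space M)" using dec_c by (rule inj_on_inverseI)
  \<comment> \<open>The orbit relation enters only through its measurable supersets
    \<open>H\<close>, so that Fubini applies to a measurable set.\<close>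
  have orbit_conull: "AE p in M \<Otimes>\<^sub>M M. p \<in> H"
    if H: "H \<in> sets (M \<Otimes>\<^sub>M M)"
      "\<And>x y. x \<in> space M \<Longrightarrow> y \<in> space M \<Longrightarrow> y \<in> orbit act x \<Longrightarrow> (x, y) \<in> H" for H
  proof (rule AE_pair_if_AE_reflections[OF M.prob_space_axioms model(1,2,3) _ H(1)])
    show "AE x in M. 0 < \<phi> x \<and> \<phi> x < 1" using model(6) by eventually_elim simp
    fix t :: real assume "t \<in> {0<..<1}"
    then obtain T where T: "T \<in> mp_bijections M" "AE x in M. T x = \<psi> (circle_reflection t (\<phi> x))"
      using reflection_mp_bijection[OF c inj model] by blast
    from T(2) orbit_full_group_AE[OF assms(5) T(1)] AE_space
    show "AE x in M. (x, \<psi> (circle_reflection t (\<phi> x))) \<in> H"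
    proof eventually_elim
      case (elim x)
      have "\<psi> (circle_reflection t (\<phi> x)) \<in> space M" using measurable_space[OF model(2)] by simp
      then show ?case using elim by (intro H(2)) simp_all
    qed
  qed
  have act [measurable]: "(\<lambda>(g, x). act g x) \<in> borel \<Otimes>\<^sub>M M \<rightarrow>\<^sub>M M"
    using assms(2) by (simp add: borel_action_def)
  \<comment> \<open>The equation \<open>c (dec r) = r\<close> holds exactly for codes of points, so
    \<open>fst\<close> maps \<open>P\<close> onto the coded orbit relation, with the group element
    as witness. Over the plane the metric form of capacitability applies.\<close>
  define P :: "((real \<times> real) \<times> 'g) set" where
    "P = {p. c (dec (fst (fst p))) = fst (fst p) \<and> c (dec (snd (fst p))) = snd (fst p) \<and>
      c (act (snd p) (dec (fst (fst p)))) = snd (fst p)}"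
  have "P \<in> sets borel"
  proof -
    have [measurable]: "(\<lambda>p :: (real \<times> real) \<times> 'g. act (snd p) (dec (fst (fst p)))) \<in> (borel \<Otimes>\<^sub>M borel) \<Otimes>\<^sub>M borel \<rightarrow>\<^sub>M M"
      using measurable_compose[OF _ act, of "\<lambda>p. (snd p, dec (fst (fst p)))" "(borel \<Otimes>\<^sub>M borel) \<Otimes>\<^sub>M borel"]
      by simp
    have "{p \<in> space ((borel \<Otimes>\<^sub>M borel) \<Otimes>\<^sub>M borel). p \<in> P} \<in> sets ((borel \<Otimes>\<^sub>M borel) \<Otimes>\<^sub>M borel)"
      unfolding P_def mem_Collect_eq by measurable
    then have "P \<in> sets ((borel \<Otimes>\<^sub>M borel) \<Otimes>\<^sub>M borel)"
      by (simp add: space_pair_measure)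
    then show ?thesis by (simp only: borel_prod)
  qed
  define pr where "pr p = (c (fst p), c (snd p))" for p
  have pr [measurable]: "pr \<in> borel_measurable (M \<Otimes>\<^sub>M M)"
    unfolding pr_def borel_prod[symmetric] by measurable
  define N where "N = distr (M \<Otimes>\<^sub>M M) borel pr"
  have sets_N: "sets N = sets borel" by (simp add: N_def)
  interpret N: prob_space N unfolding N_def by (rule MM.prob_space_distr[OF pr])
  have "1 \<le> outer_measure_of N (fst ` P)"
    unfolding outer_measure_of_def
  proof (rule INF_greatest)
    fix B assume "B \<in> {B \<in> sets N. fst ` P \<subseteq> B}"
    then have B [measurable]: "B \<in> sets borel" and "fst ` P \<subseteq> B" by (simp_all add: sets_N)
    define H where "H = pr -` B \<inter> space (M \<Otimes>\<^sub>M M)"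
    have H: "H \<in> sets (M \<Otimes>\<^sub>M M)" unfolding H_def by measurable
    have "AE p in M \<Otimes>\<^sub>M M. p \<in> H"
    proof (rule orbit_conull[OF H])
      fix x y assume xy: "x \<in> space M" "y \<in> space M" "y \<in> orbit act x"
      then obtain g where "y = act g x" by (auto simp: orbit_def)
      then have "(pr (x, y), g) \<in> P" using xy by (simp add: P_def pr_def dec_c)
      then have "fst (pr (x, y), g) \<in> B" using \<open>fst ` P \<subseteq> B\<close> by blast
      then have "pr (x, y) \<in> B" by simp
      then show "(x, y) \<in> H" using xy by (simp add: H_def space_pair_measure)
    qed
    then have "emeasure (M \<Otimes>\<^sub>M M) H = 1" using H by (simp add: MM.emeasure_eq_1_AE)
    then show "1 \<le> emeasure N B" unfolding N_def H_def by (subst emeasure_distr) auto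
  qed
  \<comment> \<open>Any constant strictly between 1/2 and 1 would serve: below the outer measure 1
    for capacitability, above 1/2 to force a large section.\<close>
  moreover have "ennreal (3/4) < 1" by (simp add: ennreal_less_one_iff)
  ultimately have "ennreal (3/4) < outer_measure_of N (fst ` P)" by (rule order.strict_trans2[rotated])
  then obtain K C where K: "compact K" "closed C" "C \<subseteq> fst ` (P \<inter> UNIV \<times> K)" "ennreal (3/4) \<le> emeasure N C"
    by (rule projection_borel_inner_regular[OF N.finite_measure_axioms sets_N \<open>P \<in> sets borel\<close>]) (rule that)
  have [measurable]: "C \<in> sets borel" using K(2) by simp
  define Q where "Q = pr -` C \<inter> space (M \<Otimes>\<^sub>M M)"
  have Q [measurable]: "Q \<in> sets (M \<Otimes>\<^sub>M M)" unfolding Q_def by measurable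
  have "ennreal (3/4) \<le> emeasure (M \<Otimes>\<^sub>M M) Q"
    using K(4) unfolding N_def Q_def by (subst (asm) emeasure_distr) auto
  also have "\<dots> = (\<integral>\<^sup>+x. emeasure M (Pair x -` Q) \<partial>M)"
    by (rule M.emeasure_pair_measure_alt[OF Q])
  finally have Q_large: "ennreal (3/4) \<le> (\<integral>\<^sup>+x. emeasure M (Pair x -` Q) \<partial>M)" .
  \<comment> \<open>Since \<open>A\<close> is conull, the large section can be found over a point at
    which the action is free.\<close>
  have "\<exists>x0\<in>A. ennreal (1/2) < emeasure M (Pair x0 -` Q)"
  proof (rule ccontr)
    assume "\<not> (\<exists>x0\<in>A. ennreal (1/2) < emeasure M (Pair x0 -` Q))"
    then have "emeasure M (Pair x -` Q) \<le> ennreal (1/2)" if "x \<in> A" for x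
      using that not_less by blast
    then have "AE x in M. emeasure M (Pair x -` Q) \<le> ennreal (1/2)"
      using A(2) by (rule eventually_mono[rotated])
    then have "(\<integral>\<^sup>+x. emeasure M (Pair x -` Q) \<partial>M) \<le> (\<integral>\<^sup>+x. ennreal (1/2) \<partial>M)"
      by (rule nn_integral_mono_AE)
    also have "\<dots> = ennreal (1/2)" by (simp add: M.emeasure_space_1)
    finally have "ennreal (3/4) \<le> ennreal (1/2)" using Q_large by (rule order_trans[rotated])
    moreover have "ennreal (1/2) < ennreal (3/4)" by (rule ennreal_lessI) simp_all
    ultimately show False by (rule leD[THEN notE])
  qed
  then obtain x0 where x0: "x0 \<in> A" "ennreal (1/2) < emeasure M (Pair x0 -` Q)" by blast
  show ?thesis
  proof (rule compact_UNIV_if_large_compact_orbit_piece[OF M.prob_space_axioms assms(2,3)])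
    show "x0 \<in> space M" using x0(1) A(1) by blast
    show "act g x0 = x0 \<Longrightarrow> g = 0" for g using A(3)[rule_format, OF _ x0(1)] by blast
    show "compact K" by (rule K(1))
    show "Pair x0 -` Q \<in> sets M" by (rule sets_Pair1[OF Q])
    show "measure M (Pair x0 -` Q) > 1/2"
      using x0(2) unfolding M.emeasure_eq_measure by (subst (asm) ennreal_less_iff) simp_all
    show "Pair x0 -` Q \<subseteq> (\<lambda>g. act g x0) ` K"
    proof
      fix y assume "y \<in> Pair x0 -` Q"
      then have "pr (x0, y) \<in> C" "y \<in> space M" by (auto simp: Q_def space_pair_measure split: if_splits)
      then have "pr (x0, y) \<in> fst ` (P \<inter> UNIV \<times> K)" using K(3) by blast
      then obtain g where "g \<in> K" "(pr (x0, y), g) \<in> P" by auto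
      then have *: "c (act g x0) = c y" using \<open>x0 \<in> space M\<close> by (simp add: P_def pr_def dec_c)
      have "(\<lambda>(g, x). act g x) (g, x0) \<in> space M"
        using \<open>x0 \<in> space M\<close> by (intro measurable_space[OF act]) (simp add: space_pair_measure)
      then have "act g x0 = y" using * inj_onD[OF inj] \<open>y \<in> space M\<close> by simp
      then show "y \<in> (\<lambda>g. act g x0) ` K" using \<open>g \<in> K\<close> by blast
    qed
  qed
qed

end
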